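(* For every positive integer $n$, every even-sunflower-free family $\mathcal{F}\subseteq 2^{\{1,\dots,n\}}$ satisfies $|\mathcal{F}|\le n$. Consequently, $f_{even}(n)=n$, where $f_{even}(n)$ denotes the maximum size of an even-sunflower-free family of subsets of $\{1,\dots,n\}$.
   Context: A nonempty family of nonempty sets is an even-sunflower if every element of the underlying set is contained in an even number of sets of the family (or in none). A family is even-sunflower-free if no subfamily of it is an even-sunflower.
   Formalization: Families are required not to contain the empty set, both in the bound and in the definition of f_even(n); otherwise the claim fails, since the empty set together with the n singletons is an even-sunflower-free family of size n+1. *)

theory Defs
  imports Main
begin

text \<open>The finiteness conjunct matters only for infinite families, where \<open>card\<close> would
  return the even number 0 for an infinite set.\<close>

definition even_sunflower :: "'a set set \<Rightarrow> bool" where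
  "even_sunflower S \<longleftrightarrow> S \<noteq> {} \<and> {} \<notin> S \<and>
     (\<forall>x. finite {A \<in> S. x \<in> A} \<and> even (card {A \<in> S. x \<in> A}))"

definition even_sunflower_free :: "'a set set \<Rightarrow> bool" where
  "even_sunflower_free F \<longleftrightarrow> \<not> (\<exists>S. S \<subseteq> F \<and> even_sunflower S)"

text \<open>Families are understood to consist of nonempty sets. The empty set belongs to no
  even-sunflower, so it could be added to any even-sunflower-free family; with it, the bound
  \<open>card F \<le> n\<close> fails, as the following fact shows for \<open>n = 1\<close>.\<close>

lemma even_sunflower_free_with_empty:
  "even_sunflower_free {{}, {1::nat}}" "{{}, {1::nat}} \<subseteq> Pow {1..1}" "card {{}, {1::nat}} = 2"
proof -
  have "\<not> even_sunflower S" if "S \<subseteq> {{}, {1::nat}}" for S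
  proof
    assume S: "even_sunflower S"
    then have "S = {{1}}" using that by (auto simp: even_sunflower_def)
    then have "{A \<in> S. 1 \<in> A} = {{1}}" by auto
    moreover have "even (card {A \<in> S. 1 \<in> A})"
      using S by (simp add: even_sunflower_def)
    ultimately show False by simp
  qed
  then show "even_sunflower_free {{}, {1::nat}}"
    by (auto simp: even_sunflower_free_def)
qed auto

definition f_even :: "nat \<Rightarrow> nat" where
  "f_even n = Max {card F | F. F \<subseteq> Pow {1..n} \<and> {} \<notin> F \<and> even_sunflower_free F}"

end

theory Submission
  imports Defs
begin

text \<open>Send each subfamily of a family on \<open>X\<close> to the set of points covered an odd number of times.
  If the family has more members than \<open>X\<close> has points, two distinct subfamilies have the same image
  by pigeonhole, and their symmetric difference is an even-sunflower. The singletons show that the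
  bound is attained.\<close>

text \<open>In \<open>card A + card B\<close> the common part \<open>A \<inter> B\<close> is counted
  twice, so modulo 2 only the symmetric difference remains.\<close>

lemma even_card_sym_diff:
  assumes "finite A" "finite B"
  shows "even (card ((A - B) \<union> (B - A))) \<longleftrightarrow> (even (card A) \<longleftrightarrow> even (card B))"
proof -
  have "card ((A - B) \<union> (B - A)) = card (A - B) + card (B - A)"
    using assms by (intro card_Un_disjoint) auto
  moreover have "card A = card (A - B) + card (A \<inter> B)"
    using assms card_Int_Diff[of A B] by simp
  moreover have "card B = card (B - A) + card (A \<inter> B)"
    using assms card_Int_Diff[of B A] by (simp add: Int_commute)
  ultimately show ?thesis by auto
qed

lemma even_sunflower_free_card_le:
  assumes "finite X" "F \<subseteq> Pow X" "{} \<notin> F" "even_sunflower_free F"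
  shows "card F \<le> card X"
proof (rule ccontr)
  assume "\<not> card F \<le> card X"
  moreover have fin: "finite F"
    using assms finite_subset by blast
  ultimately have "card (Pow X) < card (Pow F)"
    using assms(1) by (simp add: card_Pow)
  \<comment> \<open>Identifying sets with their indicator vectors over GF(2), \<open>p S\<close> is
    the sum of the members of \<open>S\<close>; a collision of \<open>p\<close> is thus a linear
    dependence among members of \<open>F\<close>.\<close>
  define p where "p S = {x \<in> X. odd (card {A \<in> S. x \<in> A})}" for S
  have "p ` Pow F \<subseteq> Pow X"
    by (auto simp: p_def)
  then have "\<not> inj_on p (Pow F)"
    using \<open>card (Pow X) < card (Pow F)\<close> assms(1) card_inj_on_le[of p "Pow F" "Pow X"] by auto
  then obtain S T where ST: "S \<subseteq> F" "T \<subseteq> F" "S \<noteq> T" "p S = p T"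
    by (auto simp: inj_on_def)
  have finST: "finite S" "finite T"
    using ST fin finite_subset by blast+
  \<comment> \<open>Members common to \<open>S\<close> and \<open>T\<close> contribute equally to
    both counts, so removing them leaves a family whose GF(2) sum is
    \<open>p S + p T = 0\<close>.\<close>
  define D where "D = (S - T) \<union> (T - S)"
  have "D \<subseteq> F"
    using ST by (auto simp: D_def)
  have "even (card {A \<in> D. x \<in> A})" for x
  proof (cases "x \<in> X")
    case True
    have "{A \<in> D. x \<in> A} = ({A \<in> S. x \<in> A} - {A \<in> T. x \<in> A}) \<union> ({A \<in> T. x \<in> A} - {A \<in> S. x \<in> A})"
      by (auto simp: D_def)
    moreover have "x \<in> p S \<longleftrightarrow> x \<in> p T"
      using ST by simp
    ultimately show ?thesis
      using True finST by (simp add: even_card_sym_diff p_def)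
  next
    case False
    \<comment> \<open>\<open>p\<close> records only points of \<open>X\<close>; a point outside lies
      in no member of \<open>F\<close>, so its count is 0.\<close>
    then have "{A \<in> D. x \<in> A} = {}"
      using \<open>D \<subseteq> F\<close> assms(2) by auto
    then show ?thesis by (simp only: card.empty even_zero)
  qed
  moreover have "D \<noteq> {}" "{} \<notin> D" "finite D"
    using ST \<open>D \<subseteq> F\<close> assms(3) finST by (auto simp: D_def)
  ultimately have "even_sunflower D"
    by (simp add: even_sunflower_def)
  then show False
    using assms(4) \<open>D \<subseteq> F\<close> by (auto simp: even_sunflower_free_def)
qed

text \<open>A nonempty subfamily contains some \<open>{x}\<close>, and no other singleton covers
  \<open>x\<close>, so \<open>x\<close> is covered exactly once.\<close>

lemma even_sunflower_free_singletons: "even_sunflower_free ((\<lambda>x. {x}) ` X)"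
proof -
  have "\<not> even_sunflower S" if S: "S \<subseteq> (\<lambda>x. {x}) ` X" for S
  proof
    assume sf: "even_sunflower S"
    then obtain x where "{x} \<in> S"
      using S by (auto simp: even_sunflower_def)
    then have "{A \<in> S. x \<in> A} = {{x}}"
      using S by auto
    moreover have "even (card {A \<in> S. x \<in> A})"
      using sf by (simp add: even_sunflower_def)
    ultimately show False by simp
  qed
  then show ?thesis by (auto simp: even_sunflower_free_def)
qed

theorem theorem1:
  fixes n :: nat
  assumes "n \<ge> 1"
  shows "(\<forall>F. F \<subseteq> Pow {1..n} \<and> {} \<notin> F \<and> even_sunflower_free F \<longrightarrow> card F \<le> n)
    \<and> f_even n = n"
proof
  show bound: "\<forall>F. F \<subseteq> Pow {1..n} \<and> {} \<notin> F \<and> even_sunflower_free F \<longrightarrow> card F \<le> n"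
    using even_sunflower_free_card_le[of "{1..n}"] by auto
  let ?C = "{card F | F. F \<subseteq> Pow {1..n} \<and> {} \<notin> F \<and> even_sunflower_free F}"
  let ?F = "(\<lambda>x. {x}) ` {1..n}"
  \<comment> \<open>Besides the upper bound, this gives the finiteness of \<open>?C\<close> that
    determining its \<open>Max\<close> requires.\<close>
  have "?C \<subseteq> {..n}"
    using bound by auto
  moreover have "n \<in> ?C"
  proof -
    have "card ?F = n"
      by (simp add: card_image)
    moreover have "?F \<subseteq> Pow {1..n}" "{} \<notin> ?F"
      by auto
    ultimately show ?thesis
      using even_sunflower_free_singletons[of "{1..n}"] by (smt (verit) mem_Collect_eq)
  qed
  ultimately show "f_even n = n"
    unfolding f_even_def by (intro Max_eqI) (auto intro: finite_subset)
qed

end
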